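(* Let $R$ be a finite commutative ring with nonzero identity, let $n\ge 1$ be an integer, and let $\mathbf{a}=(a_1,\ldots,a_n)\in R^n$ be such that $a_i$ is invertible for some $1\le i\le n$. Then the degree of $\mathbf{a}$ in the graph $TD(R,n)$ satisfies: (a) if $||\mathbf{a}||\neq 0$, then $\deg \mathbf{a}=|R|^{n-1}-1$; (b) if $||\mathbf{a}||=0$, then $\deg\mathbf{a}=|R|^{n-1}-2$.
   Context: For a commutative ring $R$ with nonzero identity and an integer $n\ge1$, $TD(R,n)$ is the simple graph with vertex set $R^n\setminus\{(0,\ldots,0)\}$ in which two distinct vertices $\mathbf{x},\mathbf{y}$ are adjacent if and only if $\mathbf{x}\cdot\mathbf{y}=\sum_{i=1}^n x_iy_i=0$ in $R$. For $\mathbf{a}=(a_1,\ldots,a_n)\in R^n$, $||\mathbf{a}||$ denotes $a_1^2+\cdots+a_n^2\in R$. *)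

theory Defs
  imports "HOL-Library.Cardinality" "Jordan_Normal_Form.Matrix" "Graph_Theory.Pair_Digraph"
begin

text \<open>
  Vectors in \<open>R\<^sup>n\<close> are the elements of \<^term>\<open>carrier_vec n\<close>; their coordinates are indexed by
  \<open>0, \<dots>, n - 1\<close>. As usual in Graph_Theory, a simple graph is a symmetric loop-free digraph without
  parallel arcs (locale \<^locale>\<open>pair_graph\<close> in the finite case): each edge is represented by its
  two opposite arcs, so the degree of a vertex is its \<^const>\<open>out_degree\<close>.
\<close>

definition TD :: "nat \<Rightarrow> 'a :: comm_ring_1 vec pair_pre_digraph" where
  "TD n =
    \<lparr> pverts = carrier_vec n - {0\<^sub>v n},
      parcs = {(x, y). x \<in> carrier_vec n - {0\<^sub>v n} \<and> y \<in> carrier_vec n - {0\<^sub>v n}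
                 \<and> x \<noteq> y \<and> x \<bullet> y = 0} \<rparr>"

definition sum_squares :: "'a :: comm_ring_1 vec \<Rightarrow> 'a" where
  "sum_squares a = (\<Sum>i<dim_vec a. (a $ i)\<^sup>2)"

lemma finite_carrier_vec: "finite (carrier_vec n :: 'a :: finite vec set)"
proof -
  have "carrier_vec n \<subseteq> vec_of_list ` {xs :: 'a list. set xs \<subseteq> UNIV \<and> length xs = n}"
  proof
    fix v :: "'a vec" assume "v \<in> carrier_vec n"
    then have "length (list_of_vec v) = n" and "v = vec_of_list (list_of_vec v)"
      by (auto simp: vec_list)
    then show "v \<in> vec_of_list ` {xs. set xs \<subseteq> UNIV \<and> length xs = n}"
      by blast
  qed
  then show ?thesis
    by (rule finite_subset[OF _ finite_imageI[OF finite_lists_length_eq[OF finite]]])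
qed

lemma pair_graph_TD: "pair_graph (TD n :: 'a :: {finite, comm_ring_1} vec pair_pre_digraph)"
proof
  have "parcs (TD n :: 'a vec pair_pre_digraph) \<subseteq> carrier_vec n \<times> carrier_vec n"
    by (auto simp: TD_def)
  then show "finite (parcs (TD n :: 'a vec pair_pre_digraph))"
    by (rule finite_subset) (simp add: finite_carrier_vec)
  have "sym (parcs (TD n :: 'a vec pair_pre_digraph))"
    by (auto simp: TD_def sym_def intro: comm_scalar_prod[THEN trans])
  then show "symmetric (with_proj (TD n :: 'a vec pair_pre_digraph))"
    by (simp add: symmetric_def)
qed (auto simp: TD_def finite_carrier_vec)

end

theory Submission
  imports Defs "Berlekamp_Zassenhaus.Berlekamp_Type_Based"
begin

text \<open>
  The neighbours of \<open>a\<close> are the vectors orthogonal to \<open>a\<close>, except \<open>0\<close>, and except \<open>a\<close> itself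
  when \<open>a\<close> is isotropic. So it suffices to count the kernel of the linear form \<open>y \<mapsto> a \<bullet> y\<close>.
  An invertible coordinate of \<open>a\<close> yields a vector \<open>w\<close> with \<open>a \<bullet> w = 1\<close>, and such a \<open>w\<close> splits
  the form: \<open>R\<^sup>n\<close> is the direct sum of the kernel and the free rank-one module spanned
  by \<open>w\<close>. Comparing cardinalities then shows that the kernel has \<open>|R|\<^bsup>n-1\<^esup>\<close> elements.
\<close>

lemma ex_scalar_prod_eq_1:
  fixes a :: "'a :: comm_ring_1 vec"
  assumes a: "a \<in> carrier_vec n" and i: "i < n" and unit: "a $ i dvd 1"
  shows "\<exists>w \<in> carrier_vec n. a \<bullet> w = 1"
proof -
  obtain u where u: "1 = a $ i * u"
    using unit by (elim dvdE)
  have "a \<bullet> (u \<cdot>\<^sub>v unit_vec n i) = 1"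
    using a i u by (simp add: scalar_prod_right_unit mult.commute)
  then show ?thesis
    by (intro bexI[of _ "u \<cdot>\<^sub>v unit_vec n i"]) auto
qed

text \<open>
  Every \<open>v\<close> is uniquely \<open>y + r w\<close> with \<open>a \<bullet> y = 0\<close>: applying the form forces \<open>r = a \<bullet> v\<close>.
  The kernel therefore has index \<open>|R|\<close> in \<open>R\<^sup>n\<close>.
\<close>

lemma card_scalar_prod_kernel:
  fixes a w :: "'a :: {finite, comm_ring_1} vec"
  assumes a: "a \<in> carrier_vec n" and w: "w \<in> carrier_vec n" and aw: "a \<bullet> w = 1" and n: "n \<ge> 1"
  shows "card {y \<in> carrier_vec n. a \<bullet> y = 0} = CARD('a) ^ (n - 1)"
proof -
  define K where "K = {y \<in> carrier_vec n. a \<bullet> y = 0}"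
  have form: "a \<bullet> (y + r \<cdot>\<^sub>v w) = a \<bullet> y + r" if "y \<in> carrier_vec n" for y r
    using that a w aw by (simp add: scalar_prod_add_distrib[where n = n])
  have "bij_betw (\<lambda>(y, r). y + r \<cdot>\<^sub>v w) (K \<times> (UNIV :: 'a set)) (carrier_vec n)"
  proof (rule bij_betwI[where g = "\<lambda>v. (v + (- (a \<bullet> v)) \<cdot>\<^sub>v w, a \<bullet> v)"])
    show "(\<lambda>v. (v + (- (a \<bullet> v)) \<cdot>\<^sub>v w, a \<bullet> v)) \<in> carrier_vec n \<rightarrow> K \<times> UNIV"
      using w by (auto simp: K_def form)
  next
    fix p assume "p \<in> K \<times> (UNIV :: 'a set)"
    then show "(\<lambda>v. (v + (- (a \<bullet> v)) \<cdot>\<^sub>v w, a \<bullet> v)) ((\<lambda>(y, r). y + r \<cdot>\<^sub>v w) p) = p"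
      using w by (cases p) (auto simp: K_def form intro!: eq_vecI)
  next
    fix v :: "'a vec" assume "v \<in> carrier_vec n"
    then show "(\<lambda>(y, r). y + r \<cdot>\<^sub>v w) ((\<lambda>v. (v + (- (a \<bullet> v)) \<cdot>\<^sub>v w, a \<bullet> v)) v) = v"
      using w by (auto intro!: eq_vecI)
  qed (use w in \<open>auto simp: K_def\<close>)
  then have "card (K \<times> (UNIV :: 'a set)) = card (carrier_vec n :: 'a vec set)"
    by (rule bij_betw_same_card)
  then have "card K * CARD('a) = CARD('a) ^ n"
    by (simp add: card_cartesian_product card_carrier_vec)
  also have "\<dots> = CARD('a) ^ (n - 1) * CARD('a)"
    using n power_minus_mult[of n "CARD('a)"] by linarith
  finally have "card K = CARD('a) ^ (n - 1)"
    by simp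
  then show ?thesis
    by (simp add: K_def)
qed

lemma sum_squares_eq_scalar_prod: "sum_squares a = a \<bullet> a"
  by (simp add: sum_squares_def scalar_prod_def power2_eq_square lessThan_atLeast0)

lemma out_degree_TD:
  fixes a :: "'a :: comm_ring_1 vec"
  assumes "a \<in> carrier_vec n" and "a \<noteq> 0\<^sub>v n"
  shows "out_degree (with_proj (TD n)) a = card ({y \<in> carrier_vec n. a \<bullet> y = 0} - {0\<^sub>v n, a})"
proof -
  have "out_arcs (with_proj (TD n)) a = Pair a ` ({y \<in> carrier_vec n. a \<bullet> y = 0} - {0\<^sub>v n, a})"
    using assms by (auto simp: out_arcs_def TD_def)
  then show ?thesis
    by (simp add: out_degree_def card_image inj_on_def)
qed

theorem theorem2p3:
  fixes n :: nat and a :: "'a :: {finite, comm_ring_1} vec"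
  assumes "n \<ge> 1"
    and "a \<in> carrier_vec n"
    and "\<exists>i<n. a $ i dvd 1"
  shows "(sum_squares a \<noteq> 0 \<longrightarrow>
            int (out_degree (with_proj (TD n)) a) = int CARD('a) ^ (n - 1) - 1)
       \<and> (sum_squares a = 0 \<longrightarrow>
            int (out_degree (with_proj (TD n)) a) = int CARD('a) ^ (n - 1) - 2)"
proof -
  define K where "K = {y \<in> carrier_vec n. a \<bullet> y = 0}"
  obtain w where w: "w \<in> carrier_vec n" and aw: "a \<bullet> w = 1"
    using assms ex_scalar_prod_eq_1 by blast
  have a0: "a \<noteq> 0\<^sub>v n"
    using w aw by auto
  have K: "card K = CARD('a) ^ (n - 1)"
    unfolding K_def using assms(2) w aw assms(1) by (rule card_scalar_prod_kernel)
  have deg: "out_degree (with_proj (TD n)) a = card (K - {0\<^sub>v n, a})"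
    unfolding K_def using assms(2) a0 by (rule out_degree_TD)
  have "finite K"
    by (simp add: K_def finite_carrier_vec)
  have zero_mem: "0\<^sub>v n \<in> K"
    using assms(2) by (simp add: K_def)
  have a_mem: "a \<in> K \<longleftrightarrow> sum_squares a = 0"
    using assms(2) by (simp add: K_def sum_squares_eq_scalar_prod)
  have removed: "int (card (K - S)) = int CARD('a) ^ (n - 1) - int (card S)" if "S \<subseteq> K" for S
  proof -
    have "card (K - S) + card S = card K"
      using that \<open>finite K\<close> by (metis card_Diff_subset card_mono finite_subset le_add_diff_inverse2)
    then show ?thesis
      using K by (metis add_diff_cancel_right' of_nat_add of_nat_power)
  qed
  show ?thesis
  proof (intro conjI impI)
    assume "sum_squares a \<noteq> 0"
    then have "K - {0\<^sub>v n, a} = K - {0\<^sub>v n}"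
      using a_mem by auto
    then show "int (out_degree (with_proj (TD n)) a) = int CARD('a) ^ (n - 1) - 1"
      using deg removed[of "{0\<^sub>v n}"] zero_mem by simp
  next
    assume "sum_squares a = 0"
    then show "int (out_degree (with_proj (TD n)) a) = int CARD('a) ^ (n - 1) - 2"
      using deg removed[of "{0\<^sub>v n, a}"] zero_mem a_mem a0 by simp
  qed
qed

end
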